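(* Let $\xi=(\xi^1,\xi^2,\xi^3)=(r,\theta,\phi)$ be the Bloch coordinates of a one-qubit state $\rho(\xi)$, and let $L_i(\xi)$, $h_i(\xi)$ $(i=1,2,3)$ and the $3\times3$ matrix $G=G(\xi)$ be the operators and the metric built from the Husimi function as defined in the context. Suppose that the value of $\xi$ is known approximately, with an error $\epsilon$, and let $\Pi=\Pi(\hat\xi,\xi')$ be a POVM measurement with outcomes (estimates) $\hat\xi=(\hat\xi^1,\hat\xi^2,\hat\xi^3)$ which may depend on $\xi'=\xi+\epsilon$. Put $q_\epsilon(\hat\xi|\xi)=\operatorname{tr}[\rho(\xi)\Pi(\hat\xi,\xi+\epsilon)]$ and assume that the estimation is unbiased, namely $$\xi^{i}=E_{q_\epsilon}(\hat\xi^{i}|\xi)\equiv\int\hat\xi^{i}\,q_\epsilon(\hat\xi|\xi)\,d\hat\xi\qquad(i=1,2,3)$$ for all $\xi$. Let $V_{q_\epsilon}=(v^{ij}_{q_\epsilon})$, $$v^{ij}_{q_\epsilon}=E_{q_\epsilon}\big[(\hat\xi^{i}-\xi^{i})(\hat\xi^{j}-\xi^{j})\,|\,\xi\big]\equiv\int(\hat\xi^{i}-\xi^{i})(\hat\xi^{j}-\xi^{j})\,q_\epsilon(\hat\xi|\xi)\,d\hat\xi ,$$ be the covariance matrix with respect to $q_\epsilon(\hat\xi|\xi)$. Let $A=(A^j_k)$, $B=(B^j_k)$ (row index $j$, column index $k$) be $$A^{j}_{k}(\xi)=\xi^{j}\int\operatorname{tr}\Big(\rho(\xi)\frac{\partial\Pi(\hat\xi,\xi+\epsilon)}{\partial\xi^{k}}\Big)d\hat\xi,\qquad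 B^{j}_{k}(\xi)=\delta^{j}_{k}-\int\hat\xi^{j}\operatorname{tr}\Big(\rho(\xi)\frac{\partial\Pi(\hat\xi,\xi+\epsilon)}{\partial\xi^{k}}\Big)d\hat\xi .$$ For $Y^t=(y_1,y_2,y_3)$ and $Z^t=(z_1,z_2,z_3)$ with real entries let $$T_\xi=\mathbf{1}\sum_{j=1}^{3}y_j(\hat\xi^{j}-\xi^{j}),\qquad T_h=T_h(\xi)=\sum_{j=1}^{3}z_j h_j(\xi).$$ Then $$\big(Y^{t}V_{q_\epsilon}Y\big)\big(Z^{t}GZ\big)\;\ge\;\Big|\,Y^{t}(A+B)Z-\operatorname{tr}\int T_\xi T_h\,\Pi(\hat\xi,\xi+\epsilon)\,d\hat\xi\,\Big|^{2}.$$
   Context: All operators are complex $2\times2$ matrices; $\mathbf 1$ is the $2\times 2$ identity, $\log$ is the natural logarithm, $\xi=(\xi^1,\xi^2,\xi^3)=(r,\theta,\phi)$ with $0\le r\le1$, $0\le\theta\le\pi$, $0\le\phi\le2\pi$ (the closed formulas below are read where they make sense, i.e. for $0<r<1$), and $\partial_i=\partial/\partial\xi^i$. Integrals $\int\cdots d\hat\xi$ are over the range of the outcomes $\hat\xi$ of the measurement. A POVM means that the $\Pi(\hat\xi,\xi')$ are positive semidefinite and $\int\Pi(\hat\xi,\xi')\,d\hat\xi=\mathbf 1$. Qubit state: $$\rho(\xi)=\rho(r,\theta,\phi)=\frac12\begin{pmatrix}1+r\cos\theta & re^{-i\phi}\sin\theta \\ re^{i\phi}\sin\theta & 1-r\cos\theta\end{pmatrix}.$$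 Stratonovich-Weyl kernels, with parameter $s$: $$\Delta(\theta_1,\phi_1,s)=\frac12\begin{pmatrix}1+3^{\frac{1+s}{2}}\cos\theta_1 & 3^{\frac{1+s}{2}}e^{-i\phi_1}\sin\theta_1 \\ 3^{\frac{1+s}{2}}e^{i\phi_1}\sin\theta_1 & 1-3^{\frac{1+s}{2}}\cos\theta_1\end{pmatrix}.$$ Husimi function: $Q(\xi;\theta_1,\phi_1)=\operatorname{tr}[\rho(\xi)\Delta(\theta_1,\phi_1,-1)]=\frac12\big(1+r\cos\theta_1\cos\theta+r\cos(\phi_1-\phi)\sin\theta_1\sin\theta\big)$. Operator logarithmic derivatives: $$L_i(\xi)=\int_{0}^{\pi}\int_{0}^{2\pi}\partial_i\log Q(\xi;\theta_1,\phi_1)\,\Delta(\theta_1,\phi_1,1)\,\frac{\sin\theta_1\,d\phi_1\,d\theta_1}{2\pi}.$$ Explicitly, with $\ell=\log\frac{1-r}{1+r}$, $$L_1=\frac{2r+\ell}{2r^3}\begin{pmatrix} r-3\cos\theta & -3e^{-i\phi}\sin\theta \\ -3e^{i\phi}\sin\theta & r+3\cos\theta \end{pmatrix},$$ $$L_2=\frac{3(2r+(1-r^2)\ell)}{4r^2}\begin{pmatrix} -\sin\theta & e^{-i\phi}\cos\theta \\ e^{i\phi}\cos\theta & \sin\theta \end{pmatrix},\qquad L_3=\frac{3(2r+(1-r^2)\ell)}{4r^2}\begin{pmatrix} 0 & -i e^{-i\phi}\sin\theta \\ i e^{i\phi}\sin\theta & 0 \end{pmatrix}.$$ Metric: $G=(g_{ij})$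 with $g_{ij}(\xi)=\operatorname{tr}\big(\rho(\xi)\,\tfrac12(L_iL_j+L_jL_i)\big)$. Deviation operators: $h_i(\xi)=\dfrac{\partial\rho}{\partial\xi^i}-\dfrac12(\rho L_i+L_i\rho)$.
   Formalization: Added regularity: the second moments defining V exist, Π(ξ̂,ξ+ε) has partial derivatives in ξ, and (1+|ξ̂|)|∂Π/∂ξ^k| is locally dominated by an integrable function, justifying differentiation under the integral, without which the inequality can fail. *)

theory Defs
  imports "HOL-Analysis.Analysis"
begin

definition adjoint_matrix :: "complex^'n^'m \<Rightarrow> complex^'m^'n" where
  "adjoint_matrix M = (\<chi> i j. cnj (M $ j $ i))"

definition hermitian :: "complex^'n^'n \<Rightarrow> bool" where
  "hermitian M \<longleftrightarrow> adjoint_matrix M = M"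

definition positive_semidefinite :: "complex^'n^'n \<Rightarrow> bool" where
  "positive_semidefinite M \<longleftrightarrow>
     hermitian M \<and> (\<forall>v. 0 \<le> Re (\<Sum>i\<in>UNIV. cnj (v $ i) * (M *v v) $ i))"

text \<open>
  A point \<open>\<xi> :: real^3\<close> is the coordinate triple \<open>(r, \<theta>, \<phi>)\<close>. The pure states \<open>r = 1\<close> and the
  centre \<open>r = 0\<close> are left out, because the closed formulas for the logarithmic derivatives do not
  make sense there.
\<close>

definition bloch_domain :: "(real^3) set" where
  "bloch_domain = {\<xi>. 0 < \<xi>$1 \<and> \<xi>$1 < 1 \<and> 0 \<le> \<xi>$2 \<and> \<xi>$2 \<le> pi \<and> 0 \<le> \<xi>$3 \<and> \<xi>$3 \<le> 2 * pi}"

text \<open>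
  Partial derivatives are taken within the domain, so they are one-sided on the faces
  \<open>\<theta> \<in> {0, pi}\<close> and \<open>\<phi> \<in> {0, 2 pi}\<close> and two-sided elsewhere.
\<close>

definition coord_slice :: "3 \<Rightarrow> real^3 \<Rightarrow> real set" where
  "coord_slice k \<xi> = {t. \<xi> + t *\<^sub>R axis k 1 \<in> bloch_domain}"

definition partial_differentiable :: "3 \<Rightarrow> (real^3 \<Rightarrow> 'a::real_normed_vector) \<Rightarrow> real^3 \<Rightarrow> bool" where
  "partial_differentiable k f \<xi> \<longleftrightarrow>
     (\<lambda>t. f (\<xi> + t *\<^sub>R axis k 1)) differentiable (at 0 within coord_slice k \<xi>)"

definition partial_deriv :: "3 \<Rightarrow> (real^3 \<Rightarrow> 'a::real_normed_vector) \<Rightarrow> real^3 \<Rightarrow> 'a" where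
  "partial_deriv k f \<xi> =
     vector_derivative (\<lambda>t. f (\<xi> + t *\<^sub>R axis k 1)) (at 0 within coord_slice k \<xi>)"

definition qubit_state :: "real^3 \<Rightarrow> complex^2^2" where
  "qubit_state \<xi> = (1/2) *\<^sub>R vector
     [vector [of_real (1 + \<xi>$1 * cos (\<xi>$2)), of_real (\<xi>$1 * sin (\<xi>$2)) * cis (- (\<xi>$3))],
      vector [of_real (\<xi>$1 * sin (\<xi>$2)) * cis (\<xi>$3), of_real (1 - \<xi>$1 * cos (\<xi>$2))]]"

definition sw_kernel :: "real \<Rightarrow> real \<Rightarrow> real \<Rightarrow> complex^2^2" where
  "sw_kernel \<theta> \<phi> s = (1/2) *\<^sub>R vector
     [vector [of_real (1 + 3 powr ((1+s)/2) * cos \<theta>), of_real (3 powr ((1+s)/2) * sin \<theta>) * cis (- \<phi>)],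
      vector [of_real (3 powr ((1+s)/2) * sin \<theta>) * cis \<phi>, of_real (1 - 3 powr ((1+s)/2) * cos \<theta>)]]"

text \<open>
  The traces below whose real part is taken are real, see \<open>trace_hermitian_real\<close>,
  \<open>husimi_trace_real\<close> and \<open>metric_trace_real\<close>.
\<close>

definition husimi :: "real^3 \<Rightarrow> real \<Rightarrow> real \<Rightarrow> real" where
  "husimi \<xi> \<theta> \<phi> = Re (trace (qubit_state \<xi> ** sw_kernel \<theta> \<phi> (-1)))"

definition log_deriv_op :: "3 \<Rightarrow> real^3 \<Rightarrow> complex^2^2" where
  "log_deriv_op i \<xi> =
     (LBINT \<theta>:{0..pi}. LBINT \<phi>:{0..2*pi}.
        (partial_deriv i (\<lambda>\<eta>. ln (husimi \<eta> \<theta> \<phi>)) \<xi> * (sin \<theta> / (2 * pi))) *\<^sub>R sw_kernel \<theta> \<phi> 1)"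

definition husimi_metric :: "real^3 \<Rightarrow> real^3^3" where
  "husimi_metric \<xi> = (\<chi> i j. Re (trace (qubit_state \<xi> **
     ((1/2) *\<^sub>R (log_deriv_op i \<xi> ** log_deriv_op j \<xi> + log_deriv_op j \<xi> ** log_deriv_op i \<xi>)))))"

definition deviation_op :: "3 \<Rightarrow> real^3 \<Rightarrow> complex^2^2" where
  "deviation_op i \<xi> = partial_deriv i qubit_state \<xi> -
     (1/2) *\<^sub>R (qubit_state \<xi> ** log_deriv_op i \<xi> + log_deriv_op i \<xi> ** qubit_state \<xi>)"

text \<open>
  The space of \<open>\<mu>\<close> is the range of the outcomes \<open>x\<close>, and \<open>\<mu>\<close> is the measure behind the notation
  \<open>dx\<close>: it is \<open>lebesgue_on \<Omega>\<close> for a continuous outcome range \<open>\<Omega>\<close>, and counting measure for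
  discrete outcomes.
\<close>

definition povm :: "(real^3) measure \<Rightarrow> (real^3 \<Rightarrow> complex^2^2) \<Rightarrow> bool" where
  "povm \<mu> E \<longleftrightarrow> (\<forall>x\<in>space \<mu>. positive_semidefinite (E x)) \<and> has_bochner_integral \<mu> E (mat 1)"

definition shifted :: "(real^3 \<Rightarrow> real^3 \<Rightarrow> complex^2^2) \<Rightarrow> real^3 \<Rightarrow> real^3 \<Rightarrow> real^3 \<Rightarrow> complex^2^2" where
  "shifted P \<epsilon> x \<xi> = P x (\<xi> + \<epsilon>)"

text \<open>
  Below, \<open>E x \<xi>\<close> stands for \<open>\<Pi>(x, \<xi> + \<epsilon>)\<close> with a fixed \<open>\<epsilon>\<close>, that is \<open>E = shifted \<Pi> \<epsilon>\<close>.
  \<open>smooth_family\<close> is the usual local domination condition under which \<open>\<integral> E x \<xi> dx\<close> and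
  \<open>\<integral> x\<^sub>j E x \<xi> dx\<close> can be differentiated in \<open>\<xi>\<close> under the integral sign.
\<close>

definition smooth_family :: "(real^3) measure \<Rightarrow> (real^3 \<Rightarrow> real^3 \<Rightarrow> complex^2^2) \<Rightarrow> bool" where
  "smooth_family \<mu> E \<longleftrightarrow>
     (\<forall>\<eta>\<in>bloch_domain. \<forall>k.
        (\<forall>x\<in>space \<mu>. partial_differentiable k (E x) \<eta>) \<and>
        (\<exists>d>0. \<exists>w. integrable \<mu> w \<and>
           (\<forall>t\<in>coord_slice k \<eta>. \<bar>t\<bar> < d \<longrightarrow>
              (\<forall>x\<in>space \<mu>. (1 + norm x) * norm (partial_deriv k (E x) (\<eta> + t *\<^sub>R axis k 1)) \<le> w x))))"

definition outcome_density :: "(real^3 \<Rightarrow> real^3 \<Rightarrow> complex^2^2) \<Rightarrow> real^3 \<Rightarrow> real^3 \<Rightarrow> real" where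
  "outcome_density E \<xi> x = Re (trace (qubit_state \<xi> ** E x \<xi>))"

definition unbiased :: "(real^3) measure \<Rightarrow> (real^3 \<Rightarrow> real^3 \<Rightarrow> complex^2^2) \<Rightarrow> bool" where
  "unbiased \<mu> E \<longleftrightarrow>
     (\<forall>\<xi>\<in>bloch_domain. \<forall>i. has_bochner_integral \<mu> (\<lambda>x. x$i * outcome_density E \<xi> x) (\<xi>$i))"

definition has_covariance :: "(real^3) measure \<Rightarrow> (real^3 \<Rightarrow> real^3 \<Rightarrow> complex^2^2) \<Rightarrow> real^3 \<Rightarrow> bool" where
  "has_covariance \<mu> E \<xi> \<longleftrightarrow>
     (\<forall>i j. integrable \<mu> (\<lambda>x. (x$i - \<xi>$i) * (x$j - \<xi>$j) * outcome_density E \<xi> x))"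

definition covariance :: "(real^3) measure \<Rightarrow> (real^3 \<Rightarrow> real^3 \<Rightarrow> complex^2^2) \<Rightarrow> real^3 \<Rightarrow> real^3^3" where
  "covariance \<mu> E \<xi> =
     (\<chi> i j. \<integral>x. (x$i - \<xi>$i) * (x$j - \<xi>$j) * outcome_density E \<xi> x \<partial>\<mu>)"

definition A_matrix :: "(real^3) measure \<Rightarrow> (real^3 \<Rightarrow> real^3 \<Rightarrow> complex^2^2) \<Rightarrow> real^3 \<Rightarrow> complex^3^3" where
  "A_matrix \<mu> E \<xi> =
     (\<chi> j k. complex_of_real (\<xi>$j) * (\<integral>x. trace (qubit_state \<xi> ** partial_deriv k (E x) \<xi>) \<partial>\<mu>))"

definition B_matrix :: "(real^3) measure \<Rightarrow> (real^3 \<Rightarrow> real^3 \<Rightarrow> complex^2^2) \<Rightarrow> real^3 \<Rightarrow> complex^3^3" where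
  "B_matrix \<mu> E \<xi> =
     (\<chi> j k. (if j = k then 1 else 0) -
        (\<integral>x. complex_of_real (x$j) * trace (qubit_state \<xi> ** partial_deriv k (E x) \<xi>) \<partial>\<mu>))"

definition T_xi :: "real^3 \<Rightarrow> real^3 \<Rightarrow> real^3 \<Rightarrow> complex^2^2" where
  "T_xi Y \<xi> x = (\<Sum>j\<in>UNIV. Y$j * (x$j - \<xi>$j)) *\<^sub>R mat 1"

definition T_h :: "real^3 \<Rightarrow> real^3 \<Rightarrow> complex^2^2" where
  "T_h Z \<xi> = (\<Sum>j\<in>UNIV. Z$j *\<^sub>R deviation_op j \<xi>)"

lemma adjoint_matrix_mult: "adjoint_matrix (M ** N) = adjoint_matrix N ** adjoint_matrix M"
  by (simp add: adjoint_matrix_def matrix_matrix_mult_def vec_eq_iff mult.commute)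

lemma adjoint_matrix_involutive [simp]: "adjoint_matrix (adjoint_matrix M) = M"
  by (simp add: adjoint_matrix_def vec_eq_iff)

lemma bounded_linear_adjoint_matrix:
  "bounded_linear (adjoint_matrix :: complex^'n^'m \<Rightarrow> complex^'m^'n)"
  unfolding linear_conv_bounded_linear [symmetric]
  by (rule linearI) (simp_all add: adjoint_matrix_def vec_eq_iff)

lemma trace_adjoint_matrix: "trace (adjoint_matrix M) = cnj (trace M)"
  by (simp add: trace_def adjoint_matrix_def)

lemma trace_hermitian_real:
  assumes "hermitian M" "hermitian N"
  shows "Im (trace (M ** N)) = 0"
proof -
  have "cnj (trace (M ** N)) = trace (M ** N)"
    using assms trace_mul_sym [of M N]
    by (simp add: hermitian_def adjoint_matrix_mult flip: trace_adjoint_matrix)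
  then show ?thesis
    by (simp add: complex_eq_iff)
qed

lemma hermitian_qubit_state: "hermitian (qubit_state \<xi>)"
  by (simp add: hermitian_def adjoint_matrix_def qubit_state_def vec_eq_iff forall_2 cis_cnj)

lemma hermitian_sw_kernel: "hermitian (sw_kernel \<theta> \<phi> s)"
  by (simp add: hermitian_def adjoint_matrix_def sw_kernel_def vec_eq_iff forall_2 cis_cnj)

lemma husimi_trace_real:
  "trace (qubit_state \<xi> ** sw_kernel \<theta> \<phi> (-1)) = complex_of_real (husimi \<xi> \<theta> \<phi>)"
  using trace_hermitian_real [OF hermitian_qubit_state [of \<xi>] hermitian_sw_kernel [of \<theta> \<phi> "-1"]]
  by (simp add: husimi_def complex_eq_iff)

lemma husimi_closed:
  "husimi \<xi> \<theta> \<phi> = (1/2) * (1 + \<xi>$1 * cos \<theta> * cos (\<xi>$2) + \<xi>$1 * cos (\<phi> - \<xi>$3) * sin \<theta> * sin (\<xi>$2))"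
  unfolding husimi_def
  by (simp add: trace_def matrix_matrix_mult_def sum_2 qubit_state_def sw_kernel_def cos_diff)
     (simp add: field_simps)

lemma hermitian_lebesgue_integral:
  fixes f :: "'a \<Rightarrow> complex^'n^'n"
  assumes "\<And>x. hermitian (f x)"
  shows "hermitian (integral\<^sup>L M f)"
proof -
  have "adjoint_matrix (integral\<^sup>L M f) = integral\<^sup>L M (\<lambda>x. adjoint_matrix (f x))"
    by (rule integral_bounded_linear' [OF bounded_linear_adjoint_matrix
          bounded_linear_adjoint_matrix, symmetric]) simp
  also have "(\<lambda>x. adjoint_matrix (f x)) = f"
    using assms by (simp add: hermitian_def)
  finally show ?thesis
    by (simp only: hermitian_def)
qed

lemma hermitian_scaleR: "hermitian M \<Longrightarrow> hermitian (c *\<^sub>R M)"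
  by (simp add: hermitian_def adjoint_matrix_def vec_eq_iff)

lemma hermitian_log_deriv_op: "hermitian (log_deriv_op i \<xi>)"
  unfolding log_deriv_op_def set_lebesgue_integral_def
  by (intro hermitian_lebesgue_integral hermitian_scaleR hermitian_sw_kernel)

lemma metric_trace_real:
  "trace (qubit_state \<xi> **
     ((1/2) *\<^sub>R (log_deriv_op i \<xi> ** log_deriv_op j \<xi> + log_deriv_op j \<xi> ** log_deriv_op i \<xi>)))
   = complex_of_real (husimi_metric \<xi> $ i $ j)"
proof -
  have *: "adjoint_matrix (M + N) = adjoint_matrix M + adjoint_matrix N" for M N :: "complex^2^2"
    by (simp add: adjoint_matrix_def vec_eq_iff)
  have "hermitian (log_deriv_op i \<xi> ** log_deriv_op j \<xi> + log_deriv_op j \<xi> ** log_deriv_op i \<xi>)"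
    using hermitian_log_deriv_op [of i \<xi>] hermitian_log_deriv_op [of j \<xi>]
    by (simp add: hermitian_def * adjoint_matrix_mult add.commute)
  from trace_hermitian_real [OF hermitian_qubit_state hermitian_scaleR [OF this]]
  show ?thesis
    by (simp add: husimi_metric_def complex_eq_iff)
qed

end

theory Submission
  imports Defs
begin

text \<open>
  Put \<open>\<rho> = qubit_state \<xi>\<close>, \<open>E x = \<Pi>(x, \<xi> + \<epsilon>)\<close>, \<open>S x = \<Sum>\<^sub>j Y\<^sub>j (x\<^sub>j - \<xi>\<^sub>j)\<close>, \<open>L = \<Sum>\<^sub>k Z\<^sub>k L\<^sub>k\<close> and
  \<open>N = \<integral> S x E x dx\<close>. Differentiating \<open>\<integral> tr(\<rho> E) = 1\<close> and \<open>\<integral> x\<^sub>j tr(\<rho> E) = \<xi>\<^sub>j\<close> in \<open>\<xi>\<^sub>k\<close> turns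
  \<open>Y\<^sup>t (A + B) Z\<close> into \<open>tr(\<rho>' N)\<close> with \<open>\<rho>' = \<Sum>\<^sub>k Z\<^sub>k \<partial>\<^sub>k\<rho>\<close>. Subtracting \<open>tr(T_h N)\<close> leaves half of
  \<open>tr((\<rho> L + L \<rho>) N)\<close>, which is the real number \<open>c = Re tr(\<rho> L N)\<close> since all three factors are
  Hermitian. Since \<open>\<rho>\<close> and \<open>E x\<close> are positive, \<open>tr((t L + S) \<rho> (t L + S) E) \<ge> 0\<close> for real \<open>t\<close>, and
  integrating over \<open>x\<close> gives \<open>t\<^sup>2 Z\<^sup>t G Z + 2 t c + Y\<^sup>t V Y \<ge> 0\<close>; the discriminant of this quadratic
  is the claim.
\<close>

section \<open>The trace pairing, rank-one matrices and positivity\<close>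

lemma bounded_bilinear_trace_mult:
  "bounded_bilinear (\<lambda>M N. trace (M ** N :: complex^'n^'n))"
  unfolding bilinear_conv_bounded_bilinear [symmetric] bilinear_def
  by (intro conjI allI linearI)
     (simp_all add: trace_def matrix_matrix_mult_def sum.distrib algebra_simps scaleR_sum_right)

interpretation tr: bounded_bilinear "\<lambda>M N. trace (M ** N :: complex^'n^'n)"
  by (rule bounded_bilinear_trace_mult)

text \<open>The rank-one matrix \<open>u u*\<close>, the projection onto the line of
  \<open>u\<close> when \<open>u\<close> is a unit vector.\<close>

definition outer :: "complex^'n \<Rightarrow> complex^'n^'n" where
  "outer u = (\<chi> i j. u $ i * cnj (u $ j))"

lemma conjugate_outer: "A ** outer u ** adjoint_matrix A = outer (A *v u)"
  by (simp add: outer_def adjoint_matrix_def matrix_matrix_mult_def matrix_vector_mult_def vec_eq_iff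
      sum_distrib_left sum_distrib_right mult_ac)

text \<open>Identifies the quadratic form in \<open>positive_semidefinite\<close> with the trace
  pairing, so that positivity can be applied to states built from rank-one matrices.\<close>

lemma trace_outer: "trace (outer w ** E) = (\<Sum>i\<in>UNIV. cnj (w $ i) * (E *v w) $ i)"
proof -
  have "trace (outer w ** E) = (\<Sum>i\<in>UNIV. \<Sum>j\<in>UNIV. w $ i * cnj (w $ j) * E $ j $ i)"
    by (simp add: trace_def outer_def matrix_matrix_mult_def)
  also have "\<dots> = (\<Sum>j\<in>UNIV. \<Sum>i\<in>UNIV. w $ i * cnj (w $ j) * E $ j $ i)"
    by (rule sum.swap)
  finally show ?thesis
    by (simp add: matrix_vector_mult_def sum_distrib_left mult_ac)
qed

lemma mat_1_eq_outer: "(mat 1 :: complex^2^2) = outer (axis 1 1) + outer (axis 2 1)"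
  by (simp add: vec_eq_iff outer_def mat_def forall_2 axis_def)

text \<open>The half angles give the unit vector whose Bloch direction is (\<open>\<theta>\<close>,
  \<open>\<phi>\<close>). For radius between 0 and 1 both coefficients are nonnegative, which
  reduces positivity statements about the state to rank-one matrices; the first coefficient is the
  smaller eigenvalue.\<close>

lemma qubit_state_eq_outer:
  "qubit_state \<xi> = ((1 - \<xi>$1) / 2) *\<^sub>R mat 1 +
     \<xi>$1 *\<^sub>R outer (vector [of_real (cos (\<xi>$2 / 2)), of_real (sin (\<xi>$2 / 2)) * cis (\<xi>$3)])"
proof -
  have c: "cos (\<xi>$2) = (cos (\<xi>$2 / 2))\<^sup>2 - (sin (\<xi>$2 / 2))\<^sup>2"
    using cos_double [of "\<xi>$2 / 2"] by simp
  have s: "sin (\<xi>$2) = 2 * sin (\<xi>$2 / 2) * cos (\<xi>$2 / 2)"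
    using sin_double [of "\<xi>$2 / 2"] by simp
  have 1: "(cos (\<xi>$2 / 2))\<^sup>2 = 1 - (sin (\<xi>$2 / 2))\<^sup>2"
    by (simp add: cos_squared_eq)
  show ?thesis
    by (simp add: vec_eq_iff outer_def mat_def forall_2 qubit_state_def c s 1 cis_cnj complex_eq_iff)
       (simp_all add: 1 cos_squared_eq [of "\<xi>$3"] power2_eq_square [symmetric] algebra_simps)
qed

interpretation mm: bounded_bilinear "(**) :: complex^'n^'n \<Rightarrow> complex^'n^'n \<Rightarrow> complex^'n^'n"
  unfolding bilinear_conv_bounded_bilinear [symmetric] bilinear_def
  by (intro conjI allI linearI)
     (simp_all add: matrix_matrix_mult_def vec_eq_iff sum.distrib algebra_simps scaleR_sum_right)

lemma hermitian_add: "hermitian A \<Longrightarrow> hermitian B \<Longrightarrow> hermitian (A + B)"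
  by (simp add: hermitian_def adjoint_matrix_def vec_eq_iff)

lemma hermitian_sum: "(\<And>i. i \<in> I \<Longrightarrow> hermitian (f i)) \<Longrightarrow> hermitian (sum f I)"
  by (simp add: hermitian_def adjoint_matrix_def vec_eq_iff)

lemma hermitian_mat_1: "hermitian (mat 1)"
  by (simp add: hermitian_def adjoint_matrix_def mat_def vec_eq_iff)

text \<open>The adjoint reverses the three factors, and cyclicity of the trace moves
  \<open>C\<close> back to the end. Hence both orders of a symmetrised product contribute the same
  real part.\<close>

lemma trace_hermitian_mult_swap:
  assumes "hermitian A" "hermitian B" "hermitian C"
  shows "trace (B ** A ** C) = cnj (trace (A ** B ** C))"
proof -
  have "cnj (trace (A ** B ** C)) = trace (C ** (B ** A))"
    using assms by (simp add: hermitian_def adjoint_matrix_mult flip: trace_adjoint_matrix)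
  then show ?thesis
    by (simp add: trace_mul_sym [of C])
qed

lemma psd_trace_outer_nonneg:
  "positive_semidefinite E \<Longrightarrow> 0 \<le> Re (trace (outer w ** E))"
  by (simp add: positive_semidefinite_def trace_outer)

lemma mult_add_scaleR_both:
  fixes X Q R :: "complex^'n^'n"
  shows "X ** (a *\<^sub>R Q + b *\<^sub>R R) ** X' = a *\<^sub>R (X ** Q ** X') + b *\<^sub>R (X ** R ** X')"
  by (simp add: vec_eq_iff matrix_matrix_mult_def sum.distrib scaleR_sum_right algebra_simps sum_distrib_left sum_distrib_right)

text \<open>Conjugation by a Hermitian \<open>X\<close> sends \<open>outer w\<close> to
  \<open>outer (X *v w)\<close>, so the sandwiched state remains a nonnegative combination of
  rank-one matrices, each of which pairs nonnegatively with \<open>E\<close>.\<close>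

lemma psd_trace_sandwich_nonneg:
  assumes E: "positive_semidefinite E" and X: "hermitian X" and r: "0 \<le> \<xi>$1" "\<xi>$1 \<le> 1"
  shows "0 \<le> Re (trace (X ** qubit_state \<xi> ** X ** E))"
proof -
  have outer: "X ** outer w ** X = outer (X *v w)" for w
    using conjugate_outer [of X w] X by (simp add: hermitian_def)
  have one: "X ** mat 1 ** X = outer (X *v axis 1 1) + outer (X *v axis 2 1)"
    using mult_add_scaleR_both [of X 1 "outer (axis 1 1)" 1 "outer (axis 2 1)" X]
    unfolding scaleR_one outer mat_1_eq_outer [symmetric] .
  show ?thesis
    unfolding qubit_state_eq_outer mult_add_scaleR_both one outer
    using r by (simp add: tr.add_left tr.scaleR_left psd_trace_outer_nonneg [OF E])
qed

section \<open>Bounds for positive semidefinite 2 x 2 matrices\<close>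

lemma psd_entries:
  fixes E :: "complex^2^2"
  assumes "positive_semidefinite E"
  shows "E$1$1 = of_real (Re (E$1$1))" "E$2$2 = of_real (Re (E$2$2))"
    "0 \<le> Re (E$1$1)" "0 \<le> Re (E$2$2)"
    "cmod (E$1$2) \<le> Re (trace E) / 2" "cmod (E$2$1) \<le> Re (trace E) / 2"
proof -
  have h: "cnj (E$j$i) = E$i$j" for i j
    using assms by (auto simp: positive_semidefinite_def hermitian_def adjoint_matrix_def vec_eq_iff)
  have q: "0 \<le> Re (cnj (v$1) * (E$1$1 * v$1 + E$1$2 * v$2) + cnj (v$2) * (E$2$1 * v$1 + E$2$2 * v$2))" for v :: "complex^2"
    using assms by (auto simp: positive_semidefinite_def matrix_vector_mult_def sum_2)
  show "E$1$1 = of_real (Re (E$1$1))" "E$2$2 = of_real (Re (E$2$2))"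
    using h [of 1 1] h [of 2 2] by (auto simp: complex_eq_iff)
  show "0 \<le> Re (E$1$1)" "0 \<le> Re (E$2$2)"
    using q [of "vector [1, 0]"] q [of "vector [0, 1]"] by simp_all
  have *: "cmod (E$1$2) \<le> Re (trace E) / 2"
  proof (cases "E$1$2 = 0")
    case True
    then show ?thesis
      using \<open>0 \<le> Re (E$1$1)\<close> \<open>0 \<le> Re (E$2$2)\<close> by (simp add: trace_def sum_2)
  next
    case False
    \<comment> \<open>The phase opposite to that of \<open>E$1$2\<close>. Testing positivity on the
      vector (1, \<open>u\<close>) makes both cross terms equal to minus the modulus, so the trace
      dominates twice that modulus.\<close>
    define u where "u = - cnj (E$1$2) / cmod (E$1$2)"
    have sq: "E$1$2 * cnj (E$1$2) = of_real (cmod (E$1$2)) * of_real (cmod (E$1$2))"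
      by (simp add: complex_norm_square [symmetric] power2_eq_square)
    have 1: "E$1$2 * u = - cmod (E$1$2)"
      using False by (simp add: u_def sq)
    have 2: "cnj u * E$2$1 = - cmod (E$1$2)"
      using arg_cong [OF 1, of cnj] by (simp add: h mult.commute)
    have "cnj u * (E$2$2 * u) =
        E$2$2 * (E$1$2 * cnj (E$1$2)) / (of_real (cmod (E$1$2)) * of_real (cmod (E$1$2)))"
      by (simp add: u_def)
    then have 3: "cnj u * (E$2$2 * u) = E$2$2"
      using False by (simp add: sq)
    have "0 \<le> Re (E$1$1 + E$1$2 * u + (cnj u * E$2$1 + cnj u * (E$2$2 * u)))"
      using q [of "vector [1, u]"] by (simp add: algebra_simps)
    then show ?thesis
      unfolding 1 2 3 by (simp add: trace_def sum_2)
  qed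
  show "cmod (E$1$2) \<le> Re (trace E) / 2" by (fact *)
  show "cmod (E$2$1) \<le> Re (trace E) / 2"
    using * h [of 1 2] by (metis complex_mod_cnj)
qed

text \<open>The norm is at most the sum of the moduli of the entries: the diagonal contributes the
  trace, and the two off-diagonal entries at most another trace.\<close>

lemma norm_psd_le:
  fixes E :: "complex^2^2"
  assumes "positive_semidefinite E"
  shows "norm E \<le> 2 * Re (trace E)"
proof -
  have "norm E \<le> (\<Sum>i\<in>UNIV. norm (E$i))"
    unfolding norm_vec_def by (rule L2_set_le_sum) simp
  also have "\<dots> \<le> (\<Sum>i\<in>UNIV. \<Sum>j\<in>UNIV. cmod (E$i$j))"
    by (rule sum_mono) (simp add: norm_vec_def L2_set_le_sum)
  also have "\<dots> = Re (E$1$1) + cmod (E$1$2) + (cmod (E$2$1) + Re (E$2$2))"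
    using psd_entries(1-4) [OF assms] by (simp add: sum_2) (metis abs_of_nonneg norm_of_real)
  also have "\<dots> \<le> 2 * Re (trace E)"
    using psd_entries(5,6) [OF assms] by (simp add: trace_def sum_2)
  finally show ?thesis .
qed

text \<open>For radius below 1 the smaller eigenvalue of the state,
  \<open>(1 - \<xi>$1) / 2\<close>, is positive, so the scalar density controls the whole matrix
  \<open>E\<close>.\<close>

lemma norm_psd_le_density:
  assumes E: "positive_semidefinite E" and r: "0 \<le> \<xi>$1" "\<xi>$1 < 1"
  shows "norm E \<le> 4 / (1 - \<xi>$1) * Re (trace (qubit_state \<xi> ** E))"
proof -
  have "(1 - \<xi>$1) / 2 * Re (trace E) \<le> Re (trace (qubit_state \<xi> ** E))"
    unfolding qubit_state_eq_outer
    using r by (simp add: tr.add_left tr.scaleR_left psd_trace_outer_nonneg [OF E])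
  then have "2 * Re (trace E) \<le> 4 / (1 - \<xi>$1) * Re (trace (qubit_state \<xi> ** E))"
    using r by (simp add: field_simps)
  with norm_psd_le [OF E] show ?thesis
    by simp
qed

section \<open>Partial derivatives along coordinate slices\<close>

lemma qubit_state_pauli:
  "qubit_state \<eta> = (1/2) *\<^sub>R mat 1
     + (\<eta>$1 * cos (\<eta>$2) / 2) *\<^sub>R vector [vector [1, 0], vector [0, -1]]
     + (\<eta>$1 * sin (\<eta>$2) * cos (\<eta>$3) / 2) *\<^sub>R vector [vector [0, 1], vector [1, 0]]
     + (\<eta>$1 * sin (\<eta>$2) * sin (\<eta>$3) / 2) *\<^sub>R vector [vector [0, - \<i>], vector [\<i>, 0]]"
  by (simp add: vec_eq_iff forall_2 qubit_state_def mat_def complex_eq_iff field_simps)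

text \<open>In the Pauli expansion the matrices are constant, so only the real coefficient functions
  have to be differentiated.\<close>

lemma partial_differentiable_qubit_state: "partial_differentiable k qubit_state \<xi>"
proof -
  have real: "f differentiable (at x within S)" if "\<exists>D. (f has_real_derivative D) (at x within S)"
    for f :: "real \<Rightarrow> real" and x S
    using that by (auto simp: real_differentiable_def)
  show ?thesis
    unfolding partial_differentiable_def qubit_state_pauli
    by (intro differentiable_add differentiable_scaleR differentiable_const real)
       (simp_all, (rule exI, (rule derivative_eq_intros refl | simp)+)+)
qed

lemma convex_bloch_domain: "convex bloch_domain"
proof -
  have c: "convex {x::real^3. x$i \<in> S}" if "convex S" for i S
    using convex_linear_vimage [OF bounded_linear.linear [OF bounded_linear_vec_nth] that, of i]
    by (simp add: vimage_def)
  have "bloch_domain = {x. x$1 \<in> {0<..<1}} \<inter> {x. x$2 \<in> {0..pi}} \<inter> {x. x$3 \<in> {0..2*pi}}"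
    by (auto simp: bloch_domain_def)
  then show ?thesis
    by (elim ssubst) (intro convex_Int c convex_real_interval)
qed

lemma convex_coord_slice: "convex (coord_slice k \<xi>)"
proof (rule convexI)
  fix s t u v :: real
  assume "s \<in> coord_slice k \<xi>" "t \<in> coord_slice k \<xi>" and uv: "0 \<le> u" "0 \<le> v" "u + v = 1"
  then have "u *\<^sub>R (\<xi> + s *\<^sub>R axis k 1) + v *\<^sub>R (\<xi> + t *\<^sub>R axis k 1) \<in> bloch_domain"
    using convex_bloch_domain by (auto simp: coord_slice_def intro: convexD)
  also have "u *\<^sub>R (\<xi> + s *\<^sub>R axis k 1) + v *\<^sub>R (\<xi> + t *\<^sub>R axis k 1)
      = (u + v) *\<^sub>R \<xi> + (u *\<^sub>R s + v *\<^sub>R t) *\<^sub>R axis k 1"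
    by (simp add: algebra_simps)
  finally show "u *\<^sub>R s + v *\<^sub>R t \<in> coord_slice k \<xi>"
    using uv by (simp add: coord_slice_def)
qed

text \<open>Guarantees that a one-sided derivative on a face of the domain is still a limit over
  nonzero increments.\<close>

lemma coord_slice_nontrivial:
  assumes "\<xi> \<in> bloch_domain"
  obtains t where "t \<in> coord_slice k \<xi>" "t \<noteq> 0"
proof -
  have "\<exists>t. t \<in> coord_slice k \<xi> \<and> t \<noteq> 0"
  proof (cases "k = 1")
    case True
    then have "(1 - \<xi>$1) / 2 \<in> coord_slice k \<xi>"
      using assms by (simp add: coord_slice_def bloch_domain_def axis_def field_simps)
    then show ?thesis
      using assms by (intro exI [of _ "(1 - \<xi>$1) / 2"]) (simp add: bloch_domain_def)
  next
    case False
    then consider "k = 2" | "k = 3" using exhaust_3 [of k] by blast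
    \<comment> \<open>A shift by a quarter turn, upwards from the first quarter and downwards
      otherwise, stays inside both [0, \<open>pi\<close>] and [0, \<open>2 * pi\<close>].\<close>
    then have "(if \<xi>$k \<le> pi / 2 then pi / 2 else - pi / 2) \<in> coord_slice k \<xi>"
      using assms by cases (auto simp: coord_slice_def bloch_domain_def axis_def)
    then show ?thesis
      by (rule_tac exI, rule_tac conjI, assumption) simp
  qed
  then show ?thesis using that by blast
qed

text \<open>A partial derivative is defined at 0 of the slice through its own base point.
  Translating the slice by \<open>t\<close> turns the derivatives at all points of a line into
  derivatives of a single function of one variable.\<close>

lemma has_vector_derivative_partial_deriv:
  assumes "partial_differentiable k f (\<xi> + t *\<^sub>R axis k 1)"
  shows "((\<lambda>s. f (\<xi> + s *\<^sub>R axis k 1)) has_vector_derivative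
      partial_deriv k f (\<xi> + t *\<^sub>R axis k 1)) (at t within coord_slice k \<xi>)"
proof -
  let ?\<eta> = "\<xi> + t *\<^sub>R axis k 1"
  have "(\<lambda>s. s - t) ` coord_slice k \<xi> = coord_slice k ?\<eta>"
  proof (intro set_eqI iffI)
    fix s assume "s \<in> coord_slice k ?\<eta>"
    then have "s + t \<in> coord_slice k \<xi>"
      by (simp add: coord_slice_def algebra_simps)
    then show "s \<in> (\<lambda>s. s - t) ` coord_slice k \<xi>"
      by (intro image_eqI [of _ _ "s + t"]) simp_all
  qed (auto simp: coord_slice_def algebra_simps)
  then have "((\<lambda>s. f (?\<eta> + s *\<^sub>R axis k 1)) has_vector_derivative partial_deriv k f ?\<eta>)
      (at (t - t) within (\<lambda>s. s - t) ` coord_slice k \<xi>)"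
    using assms unfolding partial_differentiable_def partial_deriv_def
    by (simp add: vector_derivative_works)
  moreover have "((\<lambda>s. s - t) has_vector_derivative 1) (at t within coord_slice k \<xi>)"
    by (auto intro!: derivative_eq_intros)
  ultimately have "(((\<lambda>s. f (?\<eta> + s *\<^sub>R axis k 1)) \<circ> (\<lambda>s. s - t)) has_vector_derivative
      1 *\<^sub>R partial_deriv k f ?\<eta>) (at t within coord_slice k \<xi>)"
    by (intro vector_diff_chain_within)
  then show ?thesis
    by (simp add: o_def algebra_simps)
qed

text \<open>The mean value inequality on the convex part of the slice where the derivative bound is
  available.\<close>

lemma norm_diff_le_partial_deriv_bound:
  assumes diff: "\<And>s. s \<in> coord_slice k \<xi> \<Longrightarrow> partial_differentiable k f (\<xi> + s *\<^sub>R axis k 1)"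
    and bound: "\<And>s. s \<in> coord_slice k \<xi> \<Longrightarrow> \<bar>s\<bar> < d \<Longrightarrow>
      norm (partial_deriv k f (\<xi> + s *\<^sub>R axis k 1)) \<le> B"
    and \<xi>: "\<xi> \<in> bloch_domain" and t: "t \<in> coord_slice k \<xi>" "\<bar>t\<bar> < d"
  shows "norm (f (\<xi> + t *\<^sub>R axis k 1) - f \<xi>) \<le> B * \<bar>t\<bar>"
proof -
  let ?S = "coord_slice k \<xi> \<inter> {-d<..<d}"
  have "norm (f (\<xi> + t *\<^sub>R axis k 1) - f (\<xi> + 0 *\<^sub>R axis k 1)) \<le> B * norm (t - 0)"
  proof (rule differentiable_bound [where S = ?S])
    show "convex ?S"
      by (intro convex_Int convex_coord_slice convex_real_interval)
  next
    fix s assume s: "s \<in> ?S"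
    show "((\<lambda>s. f (\<xi> + s *\<^sub>R axis k 1)) has_derivative
        (\<lambda>h. h *\<^sub>R partial_deriv k f (\<xi> + s *\<^sub>R axis k 1))) (at s within ?S)"
      using has_vector_derivative_partial_deriv [OF diff, of s] s
      by (auto simp: has_vector_derivative_def intro: has_derivative_subset)
    show "onorm (\<lambda>h. h *\<^sub>R partial_deriv k f (\<xi> + s *\<^sub>R axis k 1)) \<le> B"
    proof (rule onorm_le)
      fix h :: real
      show "norm (h *\<^sub>R partial_deriv k f (\<xi> + s *\<^sub>R axis k 1)) \<le> B * norm h"
        using mult_right_mono [OF bound [of s], of "\<bar>h\<bar>"] s by (auto simp: mult.commute)
    qed
  qed (use \<xi> t in \<open>auto simp: coord_slice_def\<close>)
  then show ?thesis by simp
qed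

text \<open>Dominated convergence is applied along sequences of increments. Convexity keeps the
  multiples of one nonzero increment by factors in [0, 1] inside the slice.\<close>

lemma coord_slice_sequence:
  assumes \<xi>: "\<xi> \<in> bloch_domain" and "0 < d"
  obtains \<tau> :: "nat \<Rightarrow> real" where "\<And>n. \<tau> n \<in> coord_slice k \<xi>" "\<And>n. \<tau> n \<noteq> 0"
    "\<And>n. \<bar>\<tau> n\<bar> < d" "\<tau> \<longlonglongrightarrow> 0"
proof -
  obtain t where t: "t \<in> coord_slice k \<xi>" "t \<noteq> 0"
    using coord_slice_nontrivial [OF \<xi>] .
  \<comment> \<open>The factor is at most 1, to stay in the slice, and makes
    \<open>c * \<bar>t\<bar>\<close> at most \<open>d / 2\<close>.\<close>
  define c where "c = min 1 (d / (2 * \<bar>t\<bar>))"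
  have c: "0 < c" "c \<le> 1" "c * \<bar>t\<bar> < d"
    using t \<open>0 < d\<close> by (auto simp: c_def min_def field_simps)
  define \<tau> where "\<tau> n = c / real (Suc n) * t" for n
  have small: "0 < c / real (Suc n)" "c / real (Suc n) \<le> c" for n
    using c by (auto simp: field_simps)
  have "0 \<in> coord_slice k \<xi>"
    using \<xi> by (simp add: coord_slice_def)
  have "\<tau> n \<in> coord_slice k \<xi>" for n
    using convexD_alt [OF convex_coord_slice \<open>0 \<in> _\<close> t(1), of "c / real (Suc n)"] small [of n] c
    by (simp add: \<tau>_def)
  moreover have "\<tau> n \<noteq> 0" for n
    using c t by (simp add: \<tau>_def)
  moreover have "\<bar>\<tau> n\<bar> < d" for n
  proof -
    have "\<bar>\<tau> n\<bar> = c / real (Suc n) * \<bar>t\<bar>"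
      using c by (simp add: \<tau>_def abs_mult)
    also have "\<dots> \<le> c * \<bar>t\<bar>"
      using small by (intro mult_right_mono) auto
    finally show ?thesis using c by simp
  qed
  moreover have "\<tau> \<longlonglongrightarrow> 0"
  proof -
    have "(\<lambda>n. (c * t) * inverse (real (Suc n))) \<longlonglongrightarrow> (c * t) * 0"
      by (intro tendsto_mult tendsto_const LIMSEQ_inverse_real_of_nat)
    moreover have "\<tau> = (\<lambda>n. (c * t) * inverse (real (Suc n)))"
      by (simp add: fun_eq_iff \<tau>_def divide_inverse mult_ac)
    ultimately show ?thesis
      by simp
  qed
  ultimately show thesis using that by blast
qed

lemma partial_difference_quotient_tendsto:
  assumes "partial_differentiable k f \<xi>" "\<xi> \<in> bloch_domain"
    and \<tau>: "\<And>n. \<tau> n \<in> coord_slice k \<xi>" "\<And>n. \<tau> n \<noteq> 0" "\<tau> \<longlonglongrightarrow> 0"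
  shows "(\<lambda>n. (1 / \<tau> n) *\<^sub>R (f (\<xi> + \<tau> n *\<^sub>R axis k 1) - f \<xi>)) \<longlonglongrightarrow> partial_deriv k f \<xi>"
proof -
  have "((\<lambda>s. f (\<xi> + s *\<^sub>R axis k 1)) has_vector_derivative partial_deriv k f \<xi>)
      (at 0 within coord_slice k \<xi>)"
    using has_vector_derivative_partial_deriv [of k f \<xi> 0] assms by simp
  then have "((\<lambda>s. norm ((f (\<xi> + s *\<^sub>R axis k 1) - f \<xi>) - s *\<^sub>R partial_deriv k f \<xi>) / \<bar>s\<bar>) \<longlongrightarrow> 0)
      (at 0 within coord_slice k \<xi>)"
    by (simp add: has_vector_derivative_def has_derivative_iff_norm)
  moreover have "filterlim \<tau> (at 0 within coord_slice k \<xi>) sequentially"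
    using \<tau> by (auto simp: filterlim_at)
  ultimately have "(\<lambda>n. norm ((f (\<xi> + \<tau> n *\<^sub>R axis k 1) - f \<xi>) - \<tau> n *\<^sub>R partial_deriv k f \<xi>) / \<bar>\<tau> n\<bar>)
      \<longlonglongrightarrow> 0"
    by (rule filterlim_compose)
  moreover have "norm ((f (\<xi> + \<tau> n *\<^sub>R axis k 1) - f \<xi>) - \<tau> n *\<^sub>R partial_deriv k f \<xi>) / \<bar>\<tau> n\<bar> =
      norm ((1 / \<tau> n) *\<^sub>R (f (\<xi> + \<tau> n *\<^sub>R axis k 1) - f \<xi>) - partial_deriv k f \<xi>)" for n
  proof -
    have "(f (\<xi> + \<tau> n *\<^sub>R axis k 1) - f \<xi>) - \<tau> n *\<^sub>R partial_deriv k f \<xi> =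
        \<tau> n *\<^sub>R ((1 / \<tau> n) *\<^sub>R (f (\<xi> + \<tau> n *\<^sub>R axis k 1) - f \<xi>) - partial_deriv k f \<xi>)"
      using \<tau>(2) [of n] by (simp add: scaleR_diff_right)
    then show ?thesis
      using \<tau>(2) [of n] by (metis abs_eq_0 nonzero_mult_div_cancel_left norm_scaleR)
  qed
  ultimately show ?thesis
    by (simp add: tendsto_norm_zero_iff LIM_zero_iff)
qed

section \<open>Differentiation under the integral sign and integrability from the density\<close>

text \<open>
  Only the factor \<open>E\<close> needs domination: in the difference quotient of
  \<open>trace (qubit_state \<eta> ** (\<integral>x. c x *\<^sub>R E x \<eta> \<partial>\<mu>))\<close> the increment of the state is paired with the
  fixed integral at \<open>\<xi>\<close>.
\<close>

lemma integral_trace_partial_deriv: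
  fixes E :: "real^3 \<Rightarrow> real^3 \<Rightarrow> complex^2^2" and c :: "real^3 \<Rightarrow> real"
  assumes smooth: "smooth_family \<mu> E" and \<xi>: "\<xi> \<in> bloch_domain"
    and c: "\<And>x. \<bar>c x\<bar> \<le> 1 + norm x"
    and int: "\<And>\<eta>. \<eta> \<in> bloch_domain \<Longrightarrow> integrable \<mu> (\<lambda>x. c x *\<^sub>R E x \<eta>)"
    and mean: "\<And>\<eta>. \<eta> \<in> bloch_domain \<Longrightarrow>
      trace (qubit_state \<eta> ** (\<integral>x. c x *\<^sub>R E x \<eta> \<partial>\<mu>)) = complex_of_real (m \<eta>)"
    and slope: "\<And>t. m (\<xi> + t *\<^sub>R axis k 1) - m \<xi> = t * \<delta>"
  shows "(\<integral>x. of_real (c x) * trace (qubit_state \<xi> ** partial_deriv k (E x) \<xi>) \<partial>\<mu>) =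
    of_real \<delta> - trace (partial_deriv k qubit_state \<xi> ** (\<integral>x. c x *\<^sub>R E x \<xi> \<partial>\<mu>))"
proof -
  let ?a = "axis k 1 :: real^3"
  have diff: "partial_differentiable k (E x) \<eta>" if "x \<in> space \<mu>" "\<eta> \<in> bloch_domain" for x \<eta>
    using smooth that by (auto simp: smooth_family_def)
  obtain d w where "0 < d" and w: "integrable \<mu> w"
    and dom': "\<forall>t\<in>coord_slice k \<xi>. \<bar>t\<bar> < d \<longrightarrow>
      (\<forall>x\<in>space \<mu>. (1 + norm x) * norm (partial_deriv k (E x) (\<xi> + t *\<^sub>R ?a)) \<le> w x)"
    using smooth [unfolded smooth_family_def, THEN bspec, OF \<xi>, THEN spec, of k, THEN conjunct2]
    by (elim exE conjE) (rule that)
  have dom: "(1 + norm x) * norm (partial_deriv k (E x) (\<xi> + t *\<^sub>R ?a)) \<le> w x"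
    if "t \<in> coord_slice k \<xi>" "\<bar>t\<bar> < d" "x \<in> space \<mu>" for t x
    using dom' that by blast
  obtain \<tau> where \<tau>: "\<And>n. \<tau> n \<in> coord_slice k \<xi>" "\<And>n. \<tau> n \<noteq> 0" "\<And>n. \<bar>\<tau> n\<bar> < d" "\<tau> \<longlonglongrightarrow> 0"
    using coord_slice_sequence [where k = k, OF \<xi> \<open>0 < d\<close>] by blast
  define \<eta> where "\<eta> n = \<xi> + \<tau> n *\<^sub>R ?a" for n
  have \<eta>: "\<eta> n \<in> bloch_domain" for n
    using \<tau> by (simp add: \<eta>_def coord_slice_def)
  have quot: "norm (c x *\<^sub>R ((1 / \<tau> n) *\<^sub>R (E x (\<eta> n) - E x \<xi>))) \<le> w x" if x: "x \<in> space \<mu>" for n x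
  proof -
    have pos: "0 < 1 + norm x"
      by (simp add: add_pos_nonneg)
    \<comment> \<open>Dividing the dominating function by \<open>1 + norm x\<close> gives a
      Lipschitz bound for \<open>E x\<close>; multiplying by \<open>\<bar>c x\<bar>\<close>
      afterwards costs at most the same factor and returns \<open>w x\<close>.\<close>
    have "norm (partial_deriv k (E x) (\<xi> + s *\<^sub>R ?a)) \<le> w x / (1 + norm x)"
      if "s \<in> coord_slice k \<xi>" "\<bar>s\<bar> < d" for s
      using dom [OF that x] pos by (simp add: pos_le_divide_eq mult.commute)
    then have "norm (E x (\<eta> n) - E x \<xi>) \<le> w x / (1 + norm x) * \<bar>\<tau> n\<bar>"
      unfolding \<eta>_def
      by (intro norm_diff_le_partial_deriv_bound [where d = d])
         (use \<tau> \<xi> diff [OF x] in \<open>auto simp: coord_slice_def\<close>)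
    then have "norm ((1 / \<tau> n) *\<^sub>R (E x (\<eta> n) - E x \<xi>)) \<le> w x / (1 + norm x)"
      using \<tau>(2) [of n] by (simp add: pos_divide_le_eq)
    then have "\<bar>c x\<bar> * norm ((1 / \<tau> n) *\<^sub>R (E x (\<eta> n) - E x \<xi>)) \<le> (1 + norm x) * (w x / (1 + norm x))"
      using c by (intro mult_mono) auto
    also have "\<dots> = w x"
      using pos by simp
    finally show ?thesis by simp
  qed
  have \<rho>': "(\<lambda>n. (1 / \<tau> n) *\<^sub>R (qubit_state (\<eta> n) - qubit_state \<xi>)) \<longlonglongrightarrow> partial_deriv k qubit_state \<xi>"
    unfolding \<eta>_def
    by (rule partial_difference_quotient_tendsto) (use partial_differentiable_qubit_state \<xi> \<tau> in auto)
  \<comment> \<open>Continuity of the state along the sequence: a convergent difference quotient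
    times an increment tending to 0.\<close>
  have "(\<lambda>n. \<tau> n *\<^sub>R ((1 / \<tau> n) *\<^sub>R (qubit_state (\<eta> n) - qubit_state \<xi>))) \<longlonglongrightarrow> 0 *\<^sub>R partial_deriv k qubit_state \<xi>"
    by (intro tendsto_scaleR \<tau> \<rho>')
  then have \<rho>: "(\<lambda>n. qubit_state (\<eta> n)) \<longlonglongrightarrow> qubit_state \<xi>"
    using \<tau>(2) by (simp add: LIM_zero_iff)
  obtain K where "\<And>n. norm (qubit_state (\<eta> n)) \<le> K"
    using convergent_imp_Bseq [OF convergentI [OF \<rho>]] by (auto simp: Bseq_def)
  moreover obtain C where "0 \<le> C" and
    "\<And>M N :: complex^2^2. norm (trace (M ** N)) \<le> norm M * norm N * C"
    using tr.nonneg_bounded by blast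
  ultimately have bound: "norm (trace (qubit_state (\<eta> n) ** M)) \<le> K * norm M * C" for n M
    by (meson mult_right_mono norm_ge_zero order_trans)
  have "0 \<le> K * C"
    using \<open>0 \<le> C\<close> \<open>norm (qubit_state (\<eta> 0)) \<le> K\<close> norm_ge_zero order_trans by (intro mult_nonneg_nonneg) blast+
  let ?I = "\<lambda>\<eta>. \<integral>x. c x *\<^sub>R E x \<eta> \<partial>\<mu>"
  let ?q = "\<lambda>n x. (1 / \<tau> n) *\<^sub>R (E x (\<eta> n) - E x \<xi>)"
  let ?F = "\<lambda>n x. trace (qubit_state (\<eta> n) ** (c x *\<^sub>R ?q n x))"
  have cq: "(\<lambda>x. c x *\<^sub>R ?q n x) = (\<lambda>x. (1 / \<tau> n) *\<^sub>R (c x *\<^sub>R E x (\<eta> n) - c x *\<^sub>R E x \<xi>))" for n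
    by (simp add: scaleR_diff_right mult.commute)
  have icq: "integrable \<mu> (\<lambda>x. c x *\<^sub>R ?q n x)" for n
    unfolding cq by (intro integrable_scaleR_right Bochner_Integration.integrable_diff int \<eta> \<xi>)
  have iF: "integrable \<mu> (?F n)" for n
    by (rule integrable_bounded_linear [OF tr.bounded_linear_right icq])
  have "integral\<^sup>L \<mu> (?F n) = trace (qubit_state (\<eta> n) ** (\<integral>x. c x *\<^sub>R ?q n x \<partial>\<mu>))" for n
    by (rule integral_bounded_linear [OF tr.bounded_linear_right icq])
  also have "\<And>n. (\<integral>x. c x *\<^sub>R ?q n x \<partial>\<mu>) = (1 / \<tau> n) *\<^sub>R (?I (\<eta> n) - ?I \<xi>)"
    unfolding cq by (simp add: Bochner_Integration.integral_diff int \<eta> \<xi>)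
  also have "\<And>n. trace (qubit_state (\<eta> n) ** ((1 / \<tau> n) *\<^sub>R (?I (\<eta> n) - ?I \<xi>))) =
      of_real \<delta> - trace ((1 / \<tau> n) *\<^sub>R (qubit_state (\<eta> n) - qubit_state \<xi>) ** ?I \<xi>)"
  proof -
    fix n
    have "of_real (m (\<eta> n)) - of_real (m \<xi>) = (of_real (\<tau> n * \<delta>) :: complex)"
      using slope [of "\<tau> n"] by (metis \<eta>_def of_real_diff)
    then have scaled: "(1 / \<tau> n) *\<^sub>R (of_real (m (\<eta> n)) - of_real (m \<xi>)) = (of_real \<delta> :: complex)"
      using \<tau>(2) [of n] by (simp add: scaleR_conv_of_real)
    \<comment> \<open>The discrete product rule: the increment of the product
      \<open>\<rho> I\<close> minus (increment of \<open>\<rho>\<close>) times \<open>I\<close> at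
      \<open>\<xi>\<close>. By \<open>mean\<close>, the first increment is that of
      \<open>m\<close>.\<close>
    have expand: "trace (qubit_state (\<eta> n) ** (?I (\<eta> n) - ?I \<xi>)) =
        (of_real (m (\<eta> n)) - of_real (m \<xi>)) - trace ((qubit_state (\<eta> n) - qubit_state \<xi>) ** ?I \<xi>)"
      using mean [OF \<eta>] mean [OF \<xi>] by (simp add: tr.diff_left tr.diff_right)
    show "trace (qubit_state (\<eta> n) ** ((1 / \<tau> n) *\<^sub>R (?I (\<eta> n) - ?I \<xi>))) =
      of_real \<delta> - trace ((1 / \<tau> n) *\<^sub>R (qubit_state (\<eta> n) - qubit_state \<xi>) ** ?I \<xi>)"
      unfolding tr.scaleR_left tr.scaleR_right expand using scaled
      by (simp only: scaleR_diff_right)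
  qed
  finally have eF: "integral\<^sup>L \<mu> (?F n) =
      of_real \<delta> - trace ((1 / \<tau> n) *\<^sub>R (qubit_state (\<eta> n) - qubit_state \<xi>) ** ?I \<xi>)" for n .
  let ?f = "\<lambda>x. of_real (c x) * trace (qubit_state \<xi> ** partial_deriv k (E x) \<xi>)"
  have lim: "(\<lambda>n. ?F n x) \<longlonglongrightarrow> ?f x" if "x \<in> space \<mu>" for x
  proof -
    have "(\<lambda>n. ?q n x) \<longlonglongrightarrow> partial_deriv k (E x) \<xi>"
      unfolding \<eta>_def by (rule partial_difference_quotient_tendsto [OF diff [OF that \<xi>] \<xi> \<tau>(1,2,4)])
    then have "(\<lambda>n. ?F n x) \<longlonglongrightarrow> trace (qubit_state \<xi> ** (c x *\<^sub>R partial_deriv k (E x) \<xi>))"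
      by (intro tr.tendsto \<rho> tendsto_scaleR tendsto_const)
    then show ?thesis
      by (simp add: tr.scaleR_right scaleR_conv_of_real [where 'a = complex])
  qed
  have "(\<lambda>n. integral\<^sup>L \<mu> (?F n)) \<longlonglongrightarrow> integral\<^sup>L \<mu> ?f"
  proof (rule integral_dominated_convergence [where w = "\<lambda>x. K * C * w x"])
    show "?f \<in> borel_measurable \<mu>"
      by (rule borel_measurable_LIMSEQ_metric [OF borel_measurable_integrable [OF iF] lim])
    show "AE x in \<mu>. norm (?F n x) \<le> K * C * w x" for n
    proof (rule AE_I2)
      fix x assume "x \<in> space \<mu>"
      have "norm (?F n x) \<le> K * C * norm (c x *\<^sub>R ?q n x)"
        using bound [of n "c x *\<^sub>R ?q n x"] by (simp add: mult_ac)
      also have "\<dots> \<le> K * C * w x"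
        by (intro mult_left_mono quot \<open>x \<in> space \<mu>\<close> \<open>0 \<le> K * C\<close>)
      finally show "norm (?F n x) \<le> K * C * w x" .
    qed
  qed (use w lim borel_measurable_integrable [OF iF] in auto)
  moreover have "(\<lambda>n. integral\<^sup>L \<mu> (?F n)) \<longlonglongrightarrow> of_real \<delta> - trace (partial_deriv k qubit_state \<xi> ** ?I \<xi>)"
    unfolding eF by (intro tendsto_diff tendsto_const tr.tendsto \<rho>')
  ultimately show ?thesis
    by (rule LIMSEQ_unique)
qed

text \<open>
  The sigma algebra of \<open>\<mu>\<close> need not make the coordinates of \<open>x\<close> measurable. Measurability of
  \<open>c x *\<^sub>R E x\<close> comes from dividing by the density, which vanishes only where \<open>E x\<close> does.
\<close>

lemma integrable_scaleR_of_density: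
  fixes E :: "real^3 \<Rightarrow> complex^2^2"
  assumes psd: "\<And>x. x \<in> space \<mu> \<Longrightarrow> positive_semidefinite (E x)" and E: "integrable \<mu> E"
    and r: "0 \<le> \<xi>$1" "\<xi>$1 < 1"
    and int: "integrable \<mu> (\<lambda>x. c x * Re (trace (qubit_state \<xi> ** E x)))"
  shows "integrable \<mu> (\<lambda>x. c x *\<^sub>R E x)"
proof -
  let ?p = "\<lambda>x. Re (trace (qubit_state \<xi> ** E x))"
  have le: "norm (E x) \<le> 4 / (1 - \<xi>$1) * ?p x" if "x \<in> space \<mu>" for x
    by (rule norm_psd_le_density [OF psd [OF that] r])
  have p: "?p \<in> borel_measurable \<mu>"
    by (intro borel_measurable_integrable integrable_Re integrable_bounded_linear [OF tr.bounded_linear_right E])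
  \<comment> \<open>Where the density is 0, \<open>le\<close> forces \<open>E x = 0\<close>, so both
    sides vanish and the value of \<open>1 / 0\<close> is harmless.\<close>
  have eq: "(c x * ?p x) *\<^sub>R ((1 / ?p x) *\<^sub>R E x) = c x *\<^sub>R E x" if "x \<in> space \<mu>" for x
    using le [OF that] by (cases "?p x = 0") auto
  have "(\<lambda>x. (c x * ?p x) *\<^sub>R ((1 / ?p x) *\<^sub>R E x)) \<in> borel_measurable \<mu>"
    by (intro borel_measurable_scaleR borel_measurable_divide borel_measurable_const p
        borel_measurable_integrable [OF int] borel_measurable_integrable [OF E])
  then have meas: "(\<lambda>x. c x *\<^sub>R E x) \<in> borel_measurable \<mu>"
    using measurable_cong [of \<mu> "\<lambda>x. (c x * ?p x) *\<^sub>R ((1 / ?p x) *\<^sub>R E x)" "\<lambda>x. c x *\<^sub>R E x" borel] eq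
    by blast
  have "integrable \<mu> (\<lambda>x. 4 / (1 - \<xi>$1) * (c x * ?p x))"
    using int by simp
  then show ?thesis
  proof (rule Bochner_Integration.integrable_bound [OF _ meas])
    show "AE x in \<mu>. norm (c x *\<^sub>R E x) \<le> norm (4 / (1 - \<xi>$1) * (c x * ?p x))"
    proof (rule AE_I2)
      fix x assume "x \<in> space \<mu>"
      have "\<bar>c x\<bar> * norm (E x) \<le> \<bar>c x\<bar> * \<bar>4 / (1 - \<xi>$1) * ?p x\<bar>"
        by (intro mult_left_mono order_trans [OF le [OF \<open>x \<in> space \<mu>\<close>] abs_ge_self] abs_ge_zero)
      then show "norm (c x *\<^sub>R E x) \<le> norm (4 / (1 - \<xi>$1) * (c x * ?p x))"
        by (simp add: abs_mult mult_ac)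
    qed
  qed
qed

section \<open>The discriminant bound and the uncertainty inequality\<close>

lemma square_le_mult_of_quadratic_nonneg:
  fixes a b c :: real
  assumes "\<And>t. 0 \<le> t\<^sup>2 * a + 2 * t * b + c" and "0 \<le> a"
  shows "b\<^sup>2 \<le> c * a"
proof (cases "a = 0")
  case True
  have "b = 0"
  proof (rule ccontr)
    assume "b \<noteq> 0"
    \<comment> \<open>With \<open>a = 0\<close> the polynomial is linear; at this \<open>t\<close>
      it takes the value -1.\<close>
    then show False
      using assms(1) [of "- (c + 1) / (2 * b)"] True by (simp add: field_simps)
  qed
  with True show ?thesis by simp
next
  case False
  \<comment> \<open>The quadratic is evaluated at its minimum.\<close>
  then show ?thesis
    using assms(1) [of "- b / a"] \<open>0 \<le> a\<close> by (simp add: field_simps power2_eq_square)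
qed

theorem theorem1:
  fixes \<mu> :: "(real^3) measure"
    and P :: "real^3 \<Rightarrow> real^3 \<Rightarrow> complex^2^2"
    and \<epsilon> \<xi> Y Z :: "real^3"
  assumes povm: "\<And>\<eta>. \<eta> \<in> bloch_domain \<Longrightarrow> povm \<mu> (\<lambda>x. shifted P \<epsilon> x \<eta>)"
    and smooth: "smooth_family \<mu> (shifted P \<epsilon>)"
    and unbiased: "unbiased \<mu> (shifted P \<epsilon>)"
    and \<xi>: "\<xi> \<in> bloch_domain"
    and cov: "has_covariance \<mu> (shifted P \<epsilon>) \<xi>"
  shows "(Y \<bullet> (covariance \<mu> (shifted P \<epsilon>) \<xi> *v Y)) * (Z \<bullet> (husimi_metric \<xi> *v Z)) \<ge>
    (cmod ((\<Sum>j\<in>UNIV. \<Sum>k\<in>UNIV. complex_of_real (Y$j) *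
              (A_matrix \<mu> (shifted P \<epsilon>) \<xi> + B_matrix \<mu> (shifted P \<epsilon>) \<xi>) $ j $ k * complex_of_real (Z$k))
           - trace (\<integral>x. T_xi Y \<xi> x ** T_h Z \<xi> ** shifted P \<epsilon> x \<xi> \<partial>\<mu>)))\<^sup>2"
proof -
  define E where "E = shifted P \<epsilon>"
  define \<rho> where "\<rho> = qubit_state \<xi>"
  define p where "p x = outcome_density E \<xi> x" for x
  define S where "S x = (\<Sum>j\<in>UNIV. Y$j * (x$j - \<xi>$j))" for x :: "real^3"
  define L where "L = (\<Sum>k\<in>UNIV. Z$k *\<^sub>R log_deriv_op k \<xi>)"
  define \<rho>' where "\<rho>' = (\<Sum>k\<in>UNIV. Z$k *\<^sub>R partial_deriv k qubit_state \<xi>)"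
  define M where "M j = (\<integral>x. (x$j) *\<^sub>R E x \<xi> \<partial>\<mu>)" for j
  define N where "N = (\<integral>x. S x *\<^sub>R E x \<xi> \<partial>\<mu>)"
  have r: "0 \<le> \<eta>$1" "\<eta>$1 < 1" if "\<eta> \<in> bloch_domain" for \<eta> :: "real^3"
    using that by (simp_all add: bloch_domain_def)
  have psd: "positive_semidefinite (E x \<eta>)" if "x \<in> space \<mu>" "\<eta> \<in> bloch_domain" for x \<eta>
    using povm that by (simp add: povm_def E_def)
  have intE: "integrable \<mu> (\<lambda>x. E x \<eta>)" and integralE: "(\<integral>x. E x \<eta> \<partial>\<mu>) = mat 1"
    if "\<eta> \<in> bloch_domain" for \<eta>
    using povm [OF that] by (auto simp: povm_def E_def has_bochner_integral_iff)
  \<comment> \<open>Unbiasedness yields integrability of the coordinate times the scalar density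
    only; the density bound lifts it to the matrices.\<close>
  have intx: "integrable \<mu> (\<lambda>x. (x$j) *\<^sub>R E x \<eta>)" if "\<eta> \<in> bloch_domain" for \<eta> j
    using unbiased that
    by (intro integrable_scaleR_of_density [OF psd intE r])
       (auto simp: unbiased_def outcome_density_def E_def has_bochner_integral_iff)
  have trace_real: "trace (qubit_state \<eta> ** E x \<eta>) = of_real (outcome_density E \<eta> x)"
    if "x \<in> space \<mu>" "\<eta> \<in> bloch_domain" for x \<eta>
    using trace_hermitian_real [OF hermitian_qubit_state, of "E x \<eta>" \<eta>] psd [OF that]
    by (simp add: positive_semidefinite_def outcome_density_def complex_eq_iff)
  have mean: "trace (qubit_state \<eta> ** (\<integral>x. (x$j) *\<^sub>R E x \<eta> \<partial>\<mu>)) = of_real (\<eta>$j)"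
    if "\<eta> \<in> bloch_domain" for \<eta> j
  proof -
    have "trace (qubit_state \<eta> ** (\<integral>x. (x$j) *\<^sub>R E x \<eta> \<partial>\<mu>)) =
        (\<integral>x. trace (qubit_state \<eta> ** ((x$j) *\<^sub>R E x \<eta>)) \<partial>\<mu>)"
      by (rule integral_bounded_linear [OF tr.bounded_linear_right intx [OF that], symmetric])
    also have "\<dots> = (\<integral>x. complex_of_real (x$j * outcome_density E \<eta> x) \<partial>\<mu>)"
      by (rule Bochner_Integration.integral_cong)
         (simp_all add: tr.scaleR_right trace_real that scaleR_conv_of_real [where 'a = complex])
    also have "\<dots> = of_real (\<integral>x. x$j * outcome_density E \<eta> x \<partial>\<mu>)"
      by (rule integral_complex_of_real)
    also have "\<dots> = of_real (\<eta>$j)"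
      using unbiased that by (auto simp: unbiased_def E_def has_bochner_integral_iff)
    finally show ?thesis .
  qed
  \<comment> \<open>The total mass is constantly 1, so its derivative \<open>\<delta>\<close> is 0.
    Left as a trace, this term matches the part \<open>- \<xi>$j *\<^sub>R mat 1\<close> in the
    expansion of \<open>N\<close>.\<close>
  have A: "A_matrix \<mu> E \<xi> $ j $ k = - of_real (\<xi>$j) * trace (partial_deriv k qubit_state \<xi>)" for j k
  proof -
    have "(\<integral>x. of_real 1 * trace (qubit_state \<xi> ** partial_deriv k (E x) \<xi>) \<partial>\<mu>) =
        of_real 0 - trace (partial_deriv k qubit_state \<xi> ** (\<integral>x. 1 *\<^sub>R E x \<xi> \<partial>\<mu>))"
    proof (rule integral_trace_partial_deriv [where m = "\<lambda>_. 1"])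
      show "trace (qubit_state \<eta> ** (\<integral>x. 1 *\<^sub>R E x \<eta> \<partial>\<mu>)) = complex_of_real 1"
        if "\<eta> \<in> bloch_domain" for \<eta>
        using that by (simp add: integralE) (simp add: trace_def sum_2 qubit_state_def complex_eq_iff field_simps)
    qed (use smooth \<xi> intE in \<open>auto simp: E_def\<close>)
    then show ?thesis
      by (simp add: A_matrix_def integralE \<xi>)
  qed
  \<comment> \<open>The mean of the coordinate \<open>j\<close> is \<open>\<eta>$j\<close>, whose
    slope is the Kronecker delta; it cancels the one in \<open>B_matrix\<close>.\<close>
  have B: "B_matrix \<mu> E \<xi> $ j $ k = trace (partial_deriv k qubit_state \<xi> ** M j)" for j k
  proof -
    have "(\<integral>x. of_real (x$j) * trace (qubit_state \<xi> ** partial_deriv k (E x) \<xi>) \<partial>\<mu>) =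
        of_real (if j = k then 1 else 0) -
        trace (partial_deriv k qubit_state \<xi> ** (\<integral>x. (x$j) *\<^sub>R E x \<xi> \<partial>\<mu>))"
    proof (rule integral_trace_partial_deriv [where m = "\<lambda>\<eta>. \<eta>$j"])
      show "\<bar>x$j\<bar> \<le> 1 + norm x" for x :: "real^3"
        using component_le_norm_cart [of x j] by simp
    qed (use smooth \<xi> intx mean in \<open>auto simp: E_def axis_def\<close>)
    then show ?thesis
      by (simp add: B_matrix_def M_def)
  qed
  have SE: "(\<lambda>x. S x *\<^sub>R E x \<xi>) = (\<lambda>x. \<Sum>j\<in>UNIV. Y$j *\<^sub>R ((x$j) *\<^sub>R E x \<xi> - \<xi>$j *\<^sub>R E x \<xi>))"
    by (simp add: S_def scaleR_sum_left scaleR_diff_left scaleR_diff_right right_diff_distrib)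
  have intS: "integrable \<mu> (\<lambda>x. S x *\<^sub>R E x \<xi>)"
    unfolding SE by (intro Bochner_Integration.integrable_sum integrable_scaleR_right
        Bochner_Integration.integrable_diff intx intE \<xi>)
  have N: "N = (\<Sum>j\<in>UNIV. Y$j *\<^sub>R (M j - \<xi>$j *\<^sub>R mat 1))"
    unfolding N_def SE M_def
    by (simp add: Bochner_Integration.integral_sum Bochner_Integration.integral_diff intx intE integralE \<xi>)
  have AB: "(\<Sum>j\<in>UNIV. \<Sum>k\<in>UNIV. of_real (Y$j) * (A_matrix \<mu> E \<xi> + B_matrix \<mu> E \<xi>) $ j $ k * of_real (Z$k))
      = trace (\<rho>' ** N)"
  proof -
    have "trace (\<rho>' ** N) = (\<Sum>j\<in>UNIV. \<Sum>k\<in>UNIV. Y$j *\<^sub>R Z$k *\<^sub>R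
        trace (partial_deriv k qubit_state \<xi> ** (M j - \<xi>$j *\<^sub>R mat 1)))"
      unfolding \<rho>'_def N tr.sum_right
      by (simp only: tr.scaleR_right tr.scaleR_left tr.sum_left scaleR_sum_right)
    then show ?thesis
      by (simp add: A B tr.diff_right tr.scaleR_right scaleR_conv_of_real [where 'a = complex] algebra_simps)
  qed
  have T: "trace (\<integral>x. T_xi Y \<xi> x ** T_h Z \<xi> ** E x \<xi> \<partial>\<mu>) = trace (T_h Z \<xi> ** N)"
  proof -
    have "T_xi Y \<xi> x ** T_h Z \<xi> ** E x \<xi> = T_h Z \<xi> ** (S x *\<^sub>R E x \<xi>)" for x
      by (simp add: T_xi_def S_def mm.scaleR_left mm.scaleR_right)
    then show ?thesis
      unfolding N_def by (simp add: integral_bounded_linear [OF mm.bounded_linear_right intS])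
  qed
  define c where "c = Re (trace (\<rho> ** L ** N))"
  have herm: "hermitian \<rho>" "hermitian L" "hermitian N"
  proof -
    have "adjoint_matrix N = (\<integral>x. adjoint_matrix (S x *\<^sub>R E x \<xi>) \<partial>\<mu>)"
      unfolding N_def by (rule integral_bounded_linear [OF bounded_linear_adjoint_matrix intS, symmetric])
    also have "\<dots> = N"
      unfolding N_def
    proof (rule Bochner_Integration.integral_cong [OF refl])
      fix x assume "x \<in> space \<mu>"
      then have "hermitian (S x *\<^sub>R E x \<xi>)"
        using psd [OF _ \<xi>] by (intro hermitian_scaleR) (simp add: positive_semidefinite_def)
      then show "adjoint_matrix (S x *\<^sub>R E x \<xi>) = S x *\<^sub>R E x \<xi>"
        by (simp add: hermitian_def)
    qed
    finally show "hermitian N"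
      by (simp add: hermitian_def)
  qed (auto simp: \<rho>_def L_def intro!: hermitian_qubit_state hermitian_sum hermitian_scaleR hermitian_log_deriv_op)
  have T_h: "T_h Z \<xi> = \<rho>' - (1/2) *\<^sub>R (\<rho> ** L + L ** \<rho>)"
    by (simp add: T_h_def deviation_op_def \<rho>'_def L_def \<rho>_def mm.sum_left mm.sum_right mm.scaleR_left mm.scaleR_right
        scaleR_diff_right scaleR_add_right sum_subtractf sum.distrib scaleR_sum_right mult.commute)
  \<comment> \<open>The traces of \<open>\<rho> ** L ** N\<close> and
    \<open>L ** \<rho> ** N\<close> are complex conjugates, so half their sum is the real number
    \<open>c\<close>.\<close>
  have cross: "trace (\<rho>' ** N) - trace (T_h Z \<xi> ** N) = of_real c"
    unfolding T_h
    by (simp add: tr.diff_left tr.scaleR_left tr.add_left trace_hermitian_mult_swap [OF herm] c_def complex_eq_iff)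
  define g where "g = Re (trace (L ** \<rho> ** L))"
  have G: "Z \<bullet> (husimi_metric \<xi> *v Z) = g"
  proof -
    define a where "a i j = Re (trace (\<rho> ** (log_deriv_op i \<xi> ** log_deriv_op j \<xi>)))" for i j
    have LL: "L ** L = (\<Sum>i\<in>UNIV. \<Sum>j\<in>UNIV. Z$j *\<^sub>R Z$i *\<^sub>R (log_deriv_op i \<xi> ** log_deriv_op j \<xi>))"
      unfolding L_def mm.sum_left
      by (simp only: mm.sum_right mm.scaleR_left mm.scaleR_right scaleR_sum_right)
    have "g = Re (trace (\<rho> ** (L ** L)))"
      unfolding g_def using trace_mul_sym [of L "\<rho> ** L"] by (simp add: matrix_mul_assoc)
    also have "\<dots> = (\<Sum>i\<in>UNIV. \<Sum>j\<in>UNIV. Z$i * Z$j * a i j)"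
      by (simp add: LL tr.sum_right tr.scaleR_right a_def mult.assoc mult.left_commute)
    finally have g: "g = (\<Sum>i\<in>UNIV. \<Sum>j\<in>UNIV. Z$i * Z$j * a i j)" .
    \<comment> \<open>\<open>a\<close> need not be symmetric, but exchanging the summation indices
      leaves \<open>g\<close> unchanged; averaging both forms produces the symmetrised product of
      the metric.\<close>
    then have g': "g = (\<Sum>i\<in>UNIV. \<Sum>j\<in>UNIV. Z$i * Z$j * a j i)"
      by (subst (asm) sum.swap) (simp add: mult.commute mult.left_commute)
    have "Z \<bullet> (husimi_metric \<xi> *v Z) = (\<Sum>i\<in>UNIV. \<Sum>j\<in>UNIV. Z$i * Z$j * ((a i j + a j i) / 2))"
      by (simp add: inner_vec_def matrix_vector_mult_def husimi_metric_def tr.scaleR_right tr.add_right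
          a_def \<rho>_def sum_distrib_left mult_ac)
    also have "\<dots> = (g + g) / 2"
      by (subst (2) g', subst g)
         (simp add: distrib_left add_divide_distrib sum.distrib sum_divide_distrib)
    finally show ?thesis by simp
  qed
  define v where "v = (\<integral>x. (S x)\<^sup>2 * p x \<partial>\<mu>)"
  have V: "Y \<bullet> (covariance \<mu> E \<xi> *v Y) = v" and intSS: "integrable \<mu> (\<lambda>x. (S x)\<^sup>2 * p x)"
  proof -
    let ?v = "\<lambda>i j x. (x$i - \<xi>$i) * (x$j - \<xi>$j) * p x"
    have int: "integrable \<mu> (?v i j)" for i j
      using cov by (simp add: has_covariance_def p_def E_def)
    have Sp: "(\<lambda>x. (S x)\<^sup>2 * p x) = (\<lambda>x. \<Sum>i\<in>UNIV. \<Sum>j\<in>UNIV. Y$i * Y$j * ?v i j x)"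
      by (simp add: S_def power2_eq_square sum_product sum_distrib_left sum_distrib_right mult_ac)
    show "integrable \<mu> (\<lambda>x. (S x)\<^sup>2 * p x)"
      unfolding Sp by (intro Bochner_Integration.integrable_sum integrable_mult_right int)
    have "v = (\<Sum>i\<in>UNIV. \<Sum>j\<in>UNIV. Y$i * Y$j * (\<integral>x. ?v i j x \<partial>\<mu>))"
      unfolding v_def Sp by (simp add: Bochner_Integration.integral_sum int)
    then show "Y \<bullet> (covariance \<mu> E \<xi> *v Y) = v"
      by (simp add: inner_vec_def matrix_vector_mult_def covariance_def p_def sum_distrib_left mult_ac)
  qed
  have int_g: "integrable \<mu> (\<lambda>x. Re (trace (L ** \<rho> ** L ** E x \<xi>)))"
    by (intro integrable_Re integrable_bounded_linear [OF tr.bounded_linear_right] intE \<xi>)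
  \<comment> \<open>\<open>L ** \<rho> ** L\<close> does not depend on the outcome, so integration
    replaces \<open>E\<close> by the identity.\<close>
  have integral_g: "(\<integral>x. Re (trace (L ** \<rho> ** L ** E x \<xi>)) \<partial>\<mu>) = g"
    using integral_Re [OF integrable_bounded_linear [OF tr.bounded_linear_right intE [OF \<xi>]], of "L ** \<rho> ** L"]
    by (simp add: integral_bounded_linear [OF tr.bounded_linear_right intE [OF \<xi>]] integralE \<xi> g_def)
  have "0 \<le> g"
    unfolding integral_g [symmetric] \<rho>_def
    by (rule Bochner_Integration.integral_nonneg_AE)
       (use psd_trace_sandwich_nonneg [OF psd [OF _ \<xi>] herm(2)] r [OF \<xi>] in auto)
  have int_c: "integrable \<mu> (\<lambda>x. Re (trace (\<rho> ** L ** (S x *\<^sub>R E x \<xi>))))"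
    by (intro integrable_Re integrable_bounded_linear [OF tr.bounded_linear_right] intS)
  have integral_c: "(\<integral>x. Re (trace (\<rho> ** L ** (S x *\<^sub>R E x \<xi>))) \<partial>\<mu>) = c"
    using integral_Re [OF integrable_bounded_linear [OF tr.bounded_linear_right intS], of "\<rho> ** L"]
    by (simp only: integral_bounded_linear [OF tr.bounded_linear_right intS] N_def c_def)
  have "0 \<le> t\<^sup>2 * g + 2 * t * c + v" for t
  proof -
    have "0 \<le> t\<^sup>2 * Re (trace (L ** \<rho> ** L ** E x \<xi>)) + 2 * t * Re (trace (\<rho> ** L ** (S x *\<^sub>R E x \<xi>)))
        + (S x)\<^sup>2 * p x" if "x \<in> space \<mu>" for x
    proof -
      \<comment> \<open>The two mixed terms of the sandwich of \<open>\<rho>\<close> by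
        \<open>?X\<close> have the same real trace against \<open>E x \<xi>\<close>, which gives the
        factor 2 in the linear coefficient.\<close>
      let ?X = "t *\<^sub>R L + S x *\<^sub>R mat 1"
      have "Re (trace (L ** \<rho> ** E x \<xi>)) = Re (trace (\<rho> ** L ** E x \<xi>))"
        using trace_hermitian_mult_swap [OF herm(1,2), of "E x \<xi>"] psd [OF that \<xi>]
        by (simp add: positive_semidefinite_def)
      moreover have "?X ** \<rho> ** ?X = t\<^sup>2 *\<^sub>R (L ** \<rho> ** L) + (t * S x) *\<^sub>R (L ** \<rho> + \<rho> ** L) + (S x)\<^sup>2 *\<^sub>R \<rho>"
        by (simp add: mm.add_left mm.add_right mm.scaleR_left mm.scaleR_right power2_eq_square algebra_simps)
      moreover have "hermitian ?X"
        by (intro hermitian_add hermitian_scaleR herm hermitian_mat_1)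
      ultimately show ?thesis
        using psd_trace_sandwich_nonneg [OF psd [OF that \<xi>], of ?X \<xi>] r [OF \<xi>]
        by (simp add: tr.add_left tr.scaleR_left tr.scaleR_right p_def outcome_density_def algebra_simps flip: \<rho>_def)
    qed
    then have "0 \<le> (\<integral>x. t\<^sup>2 * Re (trace (L ** \<rho> ** L ** E x \<xi>)) + 2 * t * Re (trace (\<rho> ** L ** (S x *\<^sub>R E x \<xi>)))
        + (S x)\<^sup>2 * p x \<partial>\<mu>)"
      by (intro Bochner_Integration.integral_nonneg_AE AE_I2)
    also have "\<dots> = t\<^sup>2 * g + 2 * t * c + v"
      by (simp add: int_g int_c intSS integral_g integral_c v_def)
    finally show ?thesis .
  qed
  then have "c\<^sup>2 \<le> v * g"
    using \<open>0 \<le> g\<close> by (rule square_le_mult_of_quadratic_nonneg)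
  then show ?thesis
    unfolding E_def [symmetric] AB T cross G V by simp
qed

end
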